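(* The only class of non-zero CMC modular surfaces in $\mathbb{E}^3$ (respectively, non-zero CMC spacelike modular surfaces in $\mathbb{E}_1^3$) are given locally by the height function $$h(x',y')=\frac{H}{2}\big((x')^2+(y')^2\big)+ax'+by'+\frac{a^2+b^2}{2H},\qquad a,b\in\mathbb{R},$$ where $H\neq 0$ is the constant mean curvature scalar and $(x',y')$ are local orthonormal coordinates on the surface with respect to the pulled back metric $\phi^*ds^2$, $\phi(x',y')=(x',y',h(x',y'))$.
   Context: $\mathbb{E}^3$ is $\mathbb{R}^3$ with the Euclidean metric, $\mathbb{E}_1^3$ is $\mathbb{R}^3$ with the metric $dx^2+dy^2-dt^2$; $ds^2$ denotes the respective ambient metric. Setting: $h:U\to\mathbb{R}^+$, $U\subset\mathbb{R}^2$ open, is log-harmonic (i.e. $\log h$ is harmonic; positive height functions of modular surfaces, $h=|F|$ with $F$ analytic, are locally exactly the log-harmonic functions). It is assumed that the local immersion $\phi(x',y')=(x',y',h(x',y'))$ into $\mathbb{E}^3$ (or the spacelike immersion into $\mathbb{E}_1^3$) is isometric and that the local coordinates $(x',y')$ are orthonormal (resp. spacelike orthonormal) with respect to $\phi^*ds^2$, and that the immersion has constant mean curvature (CMC) vector, the scalar $H$ being its third coordinate. In the paper's setup such an immersion is characterized by the two identities $$\partial_{x'x'}h+\partial_{y'y'}h=2H,\qquad (\partial_{x'}h)^2+(\partial_{y'}h)^2=2Hh,$$ the first expressing the constant mean curvature condition in these coordinates, and the second then being the log-harmonicity $h\,\Delta h=|\nabla h|^2$. *)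

theory Defs
  imports "HOL-Analysis.Analysis"
begin

definition partial :: "'a::euclidean_space \<Rightarrow> ('a \<Rightarrow> 'b::real_normed_vector) \<Rightarrow> 'a \<Rightarrow> 'b" where
  "partial e f p = frechet_derivative f (at p) e"

definition C2_on :: "'a::euclidean_space set \<Rightarrow> ('a \<Rightarrow> 'b::real_normed_vector) \<Rightarrow> bool" where
  "C2_on U f \<longleftrightarrow> f differentiable_on U \<and>
     (\<forall>e\<in>Basis. partial e f differentiable_on U \<and>
        (\<forall>e'\<in>Basis. continuous_on U (partial e' (partial e f))))"

definition laplacian :: "('a::euclidean_space \<Rightarrow> 'b::real_normed_vector) \<Rightarrow> 'a \<Rightarrow> 'b" where
  "laplacian f p = (\<Sum>e\<in>Basis. partial e (partial e f) p)"

definition harmonic_on :: "'a::euclidean_space set \<Rightarrow> ('a \<Rightarrow> real) \<Rightarrow> bool" where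
  "harmonic_on U u \<longleftrightarrow> C2_on U u \<and> (\<forall>p\<in>U. laplacian u p = 0)"

text \<open>Modular surfaces are locally exactly the graphs of the positive log-harmonic functions.\<close>

definition log_harmonic_on :: "(real \<times> real) set \<Rightarrow> (real \<times> real \<Rightarrow> real) \<Rightarrow> bool" where
  "log_harmonic_on U h \<longleftrightarrow> (\<forall>p\<in>U. 0 < h p) \<and> harmonic_on U (\<lambda>p. ln (h p))"

definition graph_map :: "(real \<times> real \<Rightarrow> real) \<Rightarrow> real \<times> real \<Rightarrow> real \<times> real \<times> real" where
  "graph_map h p = (fst p, snd p, h p)"

text \<open>The ambient metrics: the metric of \<open>\<real>\<^sup>3\<close> is the library's inner product on
  \<open>real \<times> real \<times> real\<close>, that of Minkowski space is the following form.\<close>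

definition minkowski :: "real \<times> real \<times> real \<Rightarrow> real \<times> real \<times> real \<Rightarrow> real" where
  "minkowski u v = fst u * fst v + fst (snd u) * fst (snd v) - snd (snd u) * snd (snd v)"

definition pullback_metric ::
  "(real \<times> real \<times> real \<Rightarrow> real \<times> real \<times> real \<Rightarrow> real) \<Rightarrow> (real \<times> real \<Rightarrow> real \<times> real \<times> real) \<Rightarrow>
   real \<times> real \<Rightarrow> real \<times> real \<Rightarrow> real \<times> real \<Rightarrow> real" where
  "pullback_metric B \<phi> p v w = B (frechet_derivative \<phi> (at p) v) (frechet_derivative \<phi> (at p) w)"

text \<open>For the inner product this just says that \<open>\<phi>\<close> is an immersion.\<close>

definition spacelike_immersion ::
  "(real \<times> real \<times> real \<Rightarrow> real \<times> real \<times> real \<Rightarrow> real) \<Rightarrow> (real \<times> real) set \<Rightarrow>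
   (real \<times> real \<Rightarrow> real \<times> real \<times> real) \<Rightarrow> bool" where
  "spacelike_immersion B U \<phi> \<longleftrightarrow>
     C2_on U \<phi> \<and> (\<forall>p\<in>U. \<forall>v. v \<noteq> 0 \<longrightarrow> 0 < pullback_metric B \<phi> p v v)"

text \<open>The mean curvature vector of an isometric immersion \<open>\<phi>\<close> is half its Laplace--Beltrami
  Laplacian. In coordinates that are orthonormal for the metric of the surface, the
  Laplace--Beltrami operator is the sum of the pure second partial derivatives; since the
  flat connections of Euclidean and Minkowski space coincide, the formula is the same for
  both ambient metrics. This formula is how the orthonormality of the coordinates enters. It is
  not imposed as an equation on \<open>pullback_metric\<close>: for a map of the form
  \<open>graph_map h\<close> that would force \<open>h\<close> to be locally constant, and there would be no
  surfaces with non-zero mean curvature to classify.\<close>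

definition mean_curvature_vector ::
  "(real \<times> real \<Rightarrow> real \<times> real \<times> real) \<Rightarrow> real \<times> real \<Rightarrow> real \<times> real \<times> real" where
  "mean_curvature_vector \<phi> p = (1/2) *\<^sub>R laplacian \<phi> p"

definition cmc_with_scalar ::
  "(real \<times> real) set \<Rightarrow> (real \<times> real \<Rightarrow> real \<times> real \<times> real) \<Rightarrow> real \<Rightarrow> bool" where
  "cmc_with_scalar U \<phi> H \<longleftrightarrow>
     (\<exists>v. (\<forall>p\<in>U. mean_curvature_vector \<phi> p = v) \<and> snd (snd v) = H)"

definition cmc_modular_surface ::
  "(real \<times> real \<times> real \<Rightarrow> real \<times> real \<times> real \<Rightarrow> real) \<Rightarrow> (real \<times> real) set \<Rightarrow>
   (real \<times> real \<Rightarrow> real) \<Rightarrow> real \<Rightarrow> bool" where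
  "cmc_modular_surface B U h H \<longleftrightarrow>
     log_harmonic_on U h \<and> spacelike_immersion B U (graph_map h) \<and>
     cmc_with_scalar U (graph_map h) H"

definition locally_paraboloid ::
  "(real \<times> real) set \<Rightarrow> (real \<times> real \<Rightarrow> real) \<Rightarrow> real \<Rightarrow> bool" where
  "locally_paraboloid U h H \<longleftrightarrow>
     (\<forall>p\<in>U. \<exists>V a b. open V \<and> p \<in> V \<and> V \<subseteq> U \<and>
        (\<forall>x y. (x, y) \<in> V \<longrightarrow>
           h (x, y) = H/2 * (x\<^sup>2 + y\<^sup>2) + a * x + b * y + (a\<^sup>2 + b\<^sup>2) / (2 * H)))"

end

theory Submission
  imports Defs
begin

text \<open>
  Both ambient metrics lead to the same two equations. The graph of \<open>h\<close> has mean curvature vector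
  \<open>(0, 0, \<Delta>h / 2)\<close>, so constant mean curvature \<open>H\<close> says \<open>\<Delta>h = 2H\<close>; and since
  \<open>\<Delta>(ln h) = (h \<Delta>h - |\<nabla>h|\<^sup>2) / h\<^sup>2\<close>, log-harmonicity then says \<open>|\<nabla>h|\<^sup>2 = 2Hh\<close>
  (\<open>cmc_modular_surface_iff\<close>).

  The Hessian \<open>A\<close> of \<open>h\<close> is forced by these equations pointwise, with no appeal to elliptic regularity.
  Differentiating \<open>|\<nabla>h|\<^sup>2 = 2Hh\<close> once gives \<open>A \<nabla>h = H \<nabla>h\<close>, and \<open>\<nabla>h\<close> never vanishes because
  \<open>2Hh \<noteq> 0\<close>. So \<open>H\<close> is an eigenvalue of \<open>A\<close>; as the trace is \<open>2H\<close>, the other eigenvalue is \<open>H\<close>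
  as well; and \<open>A\<close> is symmetric, so \<open>A = H I\<close> (\<open>C2_jet_hessian_scalar\<close>). On a ball the gradient is
  therefore \<open>(Hx + a, Hy + b)\<close>, and no second integration is needed: the equation
  \<open>h = |\<nabla>h|\<^sup>2 / (2H)\<close> itself returns the paraboloid with the right constant term. Conversely every
  such paraboloid solves both equations.

  Symmetry of \<open>A\<close> is essential to the argument and is proved for \<open>C\<^sup>2\<close> functions in
  \<open>C2_jet_symmetric\<close>.
\<close>

section \<open>Gradients and Hessians of functions on the plane\<close>

definition has_gradient :: "(real \<times> real \<Rightarrow> 'b::real_normed_vector) \<Rightarrow> 'b \<Rightarrow> 'b \<Rightarrow> real \<times> real \<Rightarrow> bool" where
  "has_gradient f a b p \<longleftrightarrow> (f has_derivative (\<lambda>v. fst v *\<^sub>R a + snd v *\<^sub>R b)) (at p)"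

text \<open>The functions \<open>f1, f2\<close> are the first partial derivatives of \<open>f\<close>, and \<open>fij\<close> is the derivative of
  \<open>fi\<close> in the direction \<open>j\<close>. They are parameters, rather than the values of \<open>partial\<close>, so that they
  can be explicit formulas: the functions \<open>partial e f\<close> agree with such formulas only on \<open>U\<close>.\<close>

definition C2_jet ::
  "(real \<times> real) set \<Rightarrow> (real \<times> real \<Rightarrow> 'b::real_normed_vector) \<Rightarrow>
   (real \<times> real \<Rightarrow> 'b) \<Rightarrow> (real \<times> real \<Rightarrow> 'b) \<Rightarrow> (real \<times> real \<Rightarrow> 'b) \<Rightarrow> (real \<times> real \<Rightarrow> 'b) \<Rightarrow>
   (real \<times> real \<Rightarrow> 'b) \<Rightarrow> (real \<times> real \<Rightarrow> 'b) \<Rightarrow> bool" where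
  "C2_jet U f f1 f2 f11 f12 f21 f22 \<longleftrightarrow>
     (\<forall>p\<in>U. has_gradient f (f1 p) (f2 p) p \<and>
        has_gradient f1 (f11 p) (f12 p) p \<and> has_gradient f2 (f21 p) (f22 p) p) \<and>
     continuous_on U f11 \<and> continuous_on U f12 \<and> continuous_on U f21 \<and> continuous_on U f22"

lemma Basis_plane: "Basis = {(1::real, 0::real), (0, 1)}"
  by (auto simp: Basis_prod_def)

lemma partial_eq_gradient:
  assumes "has_gradient f a b p"
  shows "partial (1, 0) f p = a" "partial (0, 1) f p = b"
  using frechet_derivative_at[OF assms[unfolded has_gradient_def], symmetric]
  by (simp_all add: partial_def)

lemma has_gradient_partials:
  assumes "f differentiable (at p)"
  shows "has_gradient f (partial (1, 0) f p) (partial (0, 1) f p) p"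
proof -
  let ?D = "frechet_derivative f (at p)"
  have D: "(f has_derivative ?D) (at p)"
    using assms frechet_derivative_works by blast
  then interpret bounded_linear ?D
    by (rule has_derivative_bounded_linear)
  have "?D v = fst v *\<^sub>R ?D (1, 0) + snd v *\<^sub>R ?D (0, 1)" for v :: "real \<times> real"
  proof -
    have "?D v = ?D (fst v *\<^sub>R (1, 0) + snd v *\<^sub>R (0, 1))"
      by simp
    then show ?thesis
      by (simp only: add scaleR)
  qed
  then have "?D = (\<lambda>v. fst v *\<^sub>R ?D (1, 0) + snd v *\<^sub>R ?D (0, 1))"
    by (rule ext)
  with D show ?thesis
    unfolding has_gradient_def partial_def by (rule has_derivative_eq_rhs)
qed

text \<open>Differentiability is a local matter; this lets functions be exchanged that agree on an open set
  only, as \<open>partial e f\<close> and an explicit formula for it do.\<close>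

lemma has_gradient_transform:
  assumes "has_gradient f a b p" "open U" "p \<in> U" "\<And>q. q \<in> U \<Longrightarrow> f q = g q"
  shows "has_gradient g a b p"
  using assms unfolding has_gradient_def by (blast intro: has_derivative_transform_within_open)

lemma C2_on_imp_jet:
  assumes "open U" "C2_on U f"
  obtains f1 f2 f11 f12 f21 f22 where "C2_jet U f f1 f2 f11 f12 f21 f22"
proof -
  have diff: "g differentiable (at p)" if "g differentiable_on U" "p \<in> U"
    for g :: "real \<times> real \<Rightarrow> 'a" and p
    using that assms(1) by (metis at_within_open differentiable_on_def)
  have "C2_jet U f (partial (1,0) f) (partial (0,1) f)
     (partial (1,0) (partial (1,0) f)) (partial (0,1) (partial (1,0) f))
     (partial (1,0) (partial (0,1) f)) (partial (0,1) (partial (0,1) f))"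
    using assms(2) unfolding C2_jet_def C2_on_def Basis_plane
    by (auto intro: has_gradient_partials diff)
  then show thesis ..
qed

lemma C2_jet_second_partials:
  assumes "open U" "C2_jet U f f1 f2 f11 f12 f21 f22" "p \<in> U"
  shows "has_gradient (partial (1,0) f) (f11 p) (f12 p) p"
    "has_gradient (partial (0,1) f) (f21 p) (f22 p) p"
proof -
  have "f1 q = partial (1,0) f q" "f2 q = partial (0,1) f q" if "q \<in> U" for q
    using assms(2) that partial_eq_gradient unfolding C2_jet_def by metis+
  then show "has_gradient (partial (1,0) f) (f11 p) (f12 p) p"
    "has_gradient (partial (0,1) f) (f21 p) (f22 p) p"
    using assms unfolding C2_jet_def by (auto intro: has_gradient_transform)
qed

lemma C2_jet_imp_C2_on:
  assumes "open U" "C2_jet U f f1 f2 f11 f12 f21 f22"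
  shows "C2_on U f"
proof -
  note second = C2_jet_second_partials[OF assms]
  have diff: "g differentiable_on U" if "\<And>p. p \<in> U \<Longrightarrow> \<exists>a b. has_gradient g a b p"
    for g :: "real \<times> real \<Rightarrow> 'a"
    using that unfolding has_gradient_def differentiable_on_def differentiable_def
    by (meson has_derivative_at_withinI)
  have cont: "continuous_on U (partial (1,0) (partial (1,0) f))"
    "continuous_on U (partial (0,1) (partial (1,0) f))"
    "continuous_on U (partial (1,0) (partial (0,1) f))"
    "continuous_on U (partial (0,1) (partial (0,1) f))"
    using assms(2) partial_eq_gradient[OF second(1)] partial_eq_gradient[OF second(2)]
    unfolding C2_jet_def by (auto cong: continuous_on_cong)
  have "f differentiable_on U" "partial (1,0) f differentiable_on U"
    "partial (0,1) f differentiable_on U"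
    using assms(2) second unfolding C2_jet_def by (blast intro: diff)+
  with cont show ?thesis
    unfolding C2_on_def Basis_plane by auto
qed

lemma C2_jet_laplacian:
  assumes "open U" "C2_jet U f f1 f2 f11 f12 f21 f22" "p \<in> U"
  shows "laplacian f p = f11 p + f22 p"
  using partial_eq_gradient(1)[OF C2_jet_second_partials(1)[OF assms]]
    partial_eq_gradient(2)[OF C2_jet_second_partials(2)[OF assms]]
  unfolding laplacian_def Basis_plane by simp

section \<open>Symmetry of the Hessian\<close>

text \<open>Two applications of the mean value theorem to the second difference of \<open>f\<close> over a square:
  first in the horizontal direction, to the increment of \<open>f\<close> across the vertical side, and then in
  the vertical direction to \<open>f1\<close>.\<close>

lemma mixed_difference_eq:
  fixes f :: "real \<Rightarrow> real \<Rightarrow> real"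
  assumes "0 < s"
    and f1: "\<And>x y. \<lbrakk>x \<in> {a..a+s}; y \<in> {b..b+s}\<rbrakk> \<Longrightarrow> ((\<lambda>t. f t y) has_real_derivative f1 x y) (at x)"
    and f12: "\<And>x y. \<lbrakk>x \<in> {a..a+s}; y \<in> {b..b+s}\<rbrakk> \<Longrightarrow> ((\<lambda>t. f1 x t) has_real_derivative f12 x y) (at y)"
  shows "\<exists>x\<in>{a..a+s}. \<exists>y\<in>{b..b+s}.
    f (a+s) (b+s) - f (a+s) b - f a (b+s) + f a b = s * s * f12 x y"
proof -
  have "\<exists>x>a. x < a + s \<and> (f (a+s) (b+s) - f (a+s) b) - (f a (b+s) - f a b)
      = (a + s - a) * (f1 x (b+s) - f1 x b)"
    using assms(1) by (intro MVT2[where f = "\<lambda>t. f t (b+s) - f t b"]) (auto intro!: DERIV_diff f1)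
  then obtain x where x: "a < x" "x < a + s"
    "(f (a+s) (b+s) - f (a+s) b) - (f a (b+s) - f a b) = s * (f1 x (b+s) - f1 x b)"
    by auto
  have "\<exists>y>b. y < b + s \<and> f1 x (b+s) - f1 x b = (b + s - b) * f12 x y"
    using assms(1) x by (intro MVT2) (auto intro!: f12)
  then obtain y where "b < y" "y < b + s" "f1 x (b+s) - f1 x b = s * f12 x y"
    by auto
  with x show ?thesis
    by (intro bexI[of _ x] bexI[of _ y]) (auto simp: algebra_simps)
qed

lemma has_gradient_real_derivative:
  fixes f :: "real \<times> real \<Rightarrow> real"
  assumes "has_gradient f c d (x, y)"
  shows "((\<lambda>t. f (t, y)) has_real_derivative c) (at x)"
    and "((\<lambda>t. f (x, t)) has_real_derivative d) (at y)"
proof -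
  have D: "(f has_derivative (\<lambda>v. fst v *\<^sub>R c + snd v *\<^sub>R d)) (at (x, y))"
    using assms unfolding has_gradient_def .
  have "((\<lambda>t. (t, y)) has_derivative (\<lambda>t. (t, 0))) (at x)"
    by (auto intro!: derivative_eq_intros)
  from has_derivative_compose[OF this D]
  show "((\<lambda>t. f (t, y)) has_real_derivative c) (at x)"
    by (simp add: has_field_derivative_def mult_commute_abs)
  have "((\<lambda>t. (x, t)) has_derivative (\<lambda>t. (0, t))) (at y)"
    by (auto intro!: derivative_eq_intros)
  from has_derivative_compose[OF this D]
  show "((\<lambda>t. f (x, t)) has_real_derivative d) (at y)"
    by (simp add: has_field_derivative_def mult_commute_abs)
qed

text \<open>The second difference of \<open>f\<close> over a small square at \<open>p\<close> does not change when the coordinates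
  are exchanged. It therefore equals the area times a value of \<open>f12\<close> and also the area times a
  value of \<open>f21\<close>, both taken near \<open>p\<close>; by continuity the two values at \<open>p\<close> agree.\<close>

lemma C2_jet_symmetric:
  fixes f :: "real \<times> real \<Rightarrow> real"
  assumes "open U" and jet: "C2_jet U f f1 f2 f11 f12 f21 f22" and "p \<in> U"
  shows "f12 p = f21 p"
proof (rule ccontr)
  assume "f12 p \<noteq> f21 p"
  define e where "e = \<bar>f12 p - f21 p\<bar> / 2"
  have "0 < e"
    using \<open>f12 p \<noteq> f21 p\<close> by (simp add: e_def)
  have near: "\<exists>d>0. \<forall>q. dist q p < d \<longrightarrow> \<bar>g q - g p\<bar> < e" if "continuous_on U g"
    for g :: "real \<times> real \<Rightarrow> real"
  proof -
    have "continuous (at p) g"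
      using that assms(1,3) continuous_on_eq_continuous_at by blast
    then show ?thesis
      using \<open>0 < e\<close> unfolding continuous_at_eps_delta dist_real_def by blast
  qed
  from near jet obtain d1 where d1: "0 < d1" "\<And>q. dist q p < d1 \<Longrightarrow> \<bar>f12 q - f12 p\<bar> < e"
    unfolding C2_jet_def by blast
  from near jet obtain d2 where d2: "0 < d2" "\<And>q. dist q p < d2 \<Longrightarrow> \<bar>f21 q - f21 p\<bar> < e"
    unfolding C2_jet_def by blast
  obtain r where r: "0 < r" "ball p r \<subseteq> U"
    using assms(1,3) open_contains_ball by blast
  \<comment> \<open>The square of side \<open>s\<close> at \<open>p\<close> has diameter at most \<open>2 * s\<close>, so it stays inside the
    three open balls around \<open>p\<close>.\<close>
  define s where "s = Min {d1, d2, r} / 3"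
  have s: "0 < s" "3 * s \<le> d1" "3 * s \<le> d2" "3 * s \<le> r"
    using d1 d2 r by (auto simp: s_def)
  obtain a b where p: "p = (a, b)"
    by fastforce
  have close: "dist (x, y) p < 3 * s" if "x \<in> {a..a+s}" "y \<in> {b..b+s}" for x y
  proof -
    have "dist (x, y) p \<le> \<bar>x - a\<bar> + \<bar>y - b\<bar>"
      unfolding p dist_Pair_Pair dist_real_def
      using sqrt_sum_squares_le_sum_abs[of "x - a" "y - b"] by simp
    also have "\<dots> < 3 * s"
      using that s(1) by auto
    finally show ?thesis .
  qed
  then have U: "(x, y) \<in> U" if "x \<in> {a..a+s}" "y \<in> {b..b+s}" for x y
    using that s(4) r(2) by (force simp: dist_commute)
  note grad = jet[unfolded C2_jet_def, THEN conjunct1, rule_format, OF U]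
  obtain x y where xy: "x \<in> {a..a+s}" "y \<in> {b..b+s}"
    "f (a+s, b+s) - f (a+s, b) - f (a, b+s) + f (a, b) = s * s * f12 (x, y)"
    using mixed_difference_eq[OF s(1), of a b "\<lambda>x y. f (x, y)" "\<lambda>x y. f1 (x, y)" "\<lambda>x y. f12 (x, y)"]
      has_gradient_real_derivative grad by blast
  obtain y' x' where xy': "x' \<in> {a..a+s}" "y' \<in> {b..b+s}"
    "f (a+s, b+s) - f (a, b+s) - f (a+s, b) + f (a, b) = s * s * f21 (x', y')"
    using mixed_difference_eq[OF s(1), of b a "\<lambda>y x. f (x, y)" "\<lambda>y x. f2 (x, y)" "\<lambda>y x. f21 (x, y)"]
      has_gradient_real_derivative grad by blast
  have "s * s * f12 (x, y) = s * s * f21 (x', y')"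
    using xy(3) xy'(3) by linarith
  then have "f12 (x, y) = f21 (x', y')"
    using s(1) by simp
  moreover have "\<bar>f12 (x, y) - f12 p\<bar> < e" "\<bar>f21 (x', y') - f21 p\<bar> < e"
    using d1(2) d2(2) close xy xy' s by (meson less_le_trans)+
  moreover have "\<bar>f12 p - f21 p\<bar> \<le> \<bar>z - f12 p\<bar> + \<bar>z - f21 p\<bar>" for z
    by linarith
  ultimately show False
    unfolding e_def by (smt (verit) field_sum_of_halves)
qed

section \<open>The two equations of a modular surface of constant mean curvature\<close>

lemma C2_jet_graph_map:
  assumes "C2_jet U h h1 h2 h11 h12 h21 h22"
  shows "C2_jet U (graph_map h) (\<lambda>p. (1, 0, h1 p)) (\<lambda>p. (0, 1, h2 p))
    (\<lambda>p. (0, 0, h11 p)) (\<lambda>p. (0, 0, h12 p)) (\<lambda>p. (0, 0, h21 p)) (\<lambda>p. (0, 0, h22 p))"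
  using assms unfolding C2_jet_def has_gradient_def graph_map_def
  by (auto intro!: derivative_eq_intros continuous_intros)

lemma C2_jet_linear_image:
  assumes T: "bounded_linear T" and jet: "C2_jet U f f1 f2 f11 f12 f21 f22"
  shows "C2_jet U (\<lambda>p. T (f p)) (\<lambda>p. T (f1 p)) (\<lambda>p. T (f2 p))
    (\<lambda>p. T (f11 p)) (\<lambda>p. T (f12 p)) (\<lambda>p. T (f21 p)) (\<lambda>p. T (f22 p))"
proof -
  interpret bounded_linear T by (rule T)
  have "has_gradient (\<lambda>p. T (g p)) (T a) (T b) q" if "has_gradient g a b q" for g a b q
    using has_derivative[OF that[unfolded has_gradient_def]]
    by (simp add: has_gradient_def add scaleR)
  then show ?thesis
    using jet unfolding C2_jet_def by (auto intro: continuous_on)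
qed

lemma C2_jet_ln:
  fixes h :: "real \<times> real \<Rightarrow> real"
  assumes "\<And>p. p \<in> U \<Longrightarrow> 0 < h p" and jet: "C2_jet U h h1 h2 h11 h12 h21 h22"
  shows "C2_jet U (\<lambda>p. ln (h p)) (\<lambda>p. h1 p / h p) (\<lambda>p. h2 p / h p)
    (\<lambda>p. h11 p / h p - h1 p * h1 p / (h p)\<^sup>2) (\<lambda>p. h12 p / h p - h1 p * h2 p / (h p)\<^sup>2)
    (\<lambda>p. h21 p / h p - h2 p * h1 p / (h p)\<^sup>2) (\<lambda>p. h22 p / h p - h2 p * h2 p / (h p)\<^sup>2)"
proof -
  have cont: "continuous_on U g" if "\<And>p. p \<in> U \<Longrightarrow> \<exists>a b. has_gradient g a b p"
    for g :: "real \<times> real \<Rightarrow> real"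
    using that has_derivative_continuous unfolding has_gradient_def
    by (meson continuous_at_imp_continuous_on)
  have [continuous_intros]: "continuous_on U h" "continuous_on U h1" "continuous_on U h2"
    using jet unfolding C2_jet_def by (blast intro: cont)+
  have ln: "has_gradient (\<lambda>p. ln (h p)) (a / h q) (b / h q) q"
    if "q \<in> U" "has_gradient h a b q" for a b q
    using that assms(1)[OF that(1)] unfolding has_gradient_def
    by (auto intro!: derivative_eq_intros simp: field_simps)
  have quot: "has_gradient (\<lambda>p. g p / h p) (a / h q - g q * c / (h q)\<^sup>2) (b / h q - g q * d / (h q)\<^sup>2) q"
    if "q \<in> U" "has_gradient g a b q" "has_gradient h c d q"
    for g :: "real \<times> real \<Rightarrow> real" and a b c d q
    using that assms(1)[OF that(1)] unfolding has_gradient_def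
    by (auto intro!: derivative_eq_intros ext simp: field_simps power2_eq_square)
  have "h p \<noteq> 0" if "p \<in> U" for p
    using assms(1)[OF that] by simp
  then show ?thesis
    using jet unfolding C2_jet_def by (auto intro!: ln quot continuous_intros)
qed

text \<open>The ambient bilinear form enters only through the immersion condition: the mean curvature vector
  and log-harmonicity depend on \<open>h\<close> alone. The smoothness of \<open>h\<close> is read off from the last
  coordinate of the graph in one direction, and \<open>ln h\<close> inherits it in the other.\<close>

lemma cmc_modular_surface_iff:
  assumes "open U"
  shows "cmc_modular_surface B U h H \<longleftrightarrow>
    (\<forall>p\<in>U. 0 < h p) \<and> spacelike_immersion B U (graph_map h) \<and>
    (\<exists>h1 h2 h11 h12 h21 h22. C2_jet U h h1 h2 h11 h12 h21 h22 \<and>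
      (\<forall>p\<in>U. h11 p + h22 p = 2 * H \<and> (h1 p)\<^sup>2 + (h2 p)\<^sup>2 = 2 * H * h p))"
proof -
  have key: "log_harmonic_on U h \<and> cmc_with_scalar U (graph_map h) H \<longleftrightarrow>
      (\<forall>p\<in>U. h11 p + h22 p = 2 * H \<and> (h1 p)\<^sup>2 + (h2 p)\<^sup>2 = 2 * H * h p)"
    if pos: "\<forall>p\<in>U. 0 < h p" and jet: "C2_jet U h h1 h2 h11 h12 h21 h22"
    for h1 h2 h11 h12 h21 h22
  proof -
    have "mean_curvature_vector (graph_map h) p = (0, 0, (h11 p + h22 p) / 2)" if "p \<in> U" for p
      using C2_jet_laplacian[OF assms C2_jet_graph_map[OF jet] that]
      by (simp add: mean_curvature_vector_def)
    then have "cmc_with_scalar U (graph_map h) H \<longleftrightarrow> (\<forall>p\<in>U. (0, 0, (h11 p + h22 p) / 2) = (0::real, 0::real, H))"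
      unfolding cmc_with_scalar_def by (cases "U = {}") auto
    also have "\<dots> \<longleftrightarrow> (\<forall>p\<in>U. h11 p + h22 p = 2 * H)"
      by auto
    finally have cmc: "cmc_with_scalar U (graph_map h) H \<longleftrightarrow> (\<forall>p\<in>U. h11 p + h22 p = 2 * H)" .
    have lnjet: "C2_jet U (\<lambda>p. ln (h p)) (\<lambda>p. h1 p / h p) (\<lambda>p. h2 p / h p)
      (\<lambda>p. h11 p / h p - h1 p * h1 p / (h p)\<^sup>2) (\<lambda>p. h12 p / h p - h1 p * h2 p / (h p)\<^sup>2)
      (\<lambda>p. h21 p / h p - h2 p * h1 p / (h p)\<^sup>2) (\<lambda>p. h22 p / h p - h2 p * h2 p / (h p)\<^sup>2)"
      using pos by (intro C2_jet_ln jet) auto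
    have "laplacian (\<lambda>p. ln (h p)) p = 0 \<longleftrightarrow> (h1 p)\<^sup>2 + (h2 p)\<^sup>2 = (h11 p + h22 p) * h p"
      if "p \<in> U" for p
    proof -
      have "0 < h p"
        using pos that by blast
      then have "laplacian (\<lambda>p. ln (h p)) p = ((h11 p + h22 p) * h p - ((h1 p)\<^sup>2 + (h2 p)\<^sup>2)) / (h p)\<^sup>2"
        unfolding C2_jet_laplacian[OF assms lnjet that] by (simp add: field_simps power2_eq_square)
      with \<open>0 < h p\<close> show ?thesis
        by auto
    qed
    then have "log_harmonic_on U h \<longleftrightarrow> (\<forall>p\<in>U. (h1 p)\<^sup>2 + (h2 p)\<^sup>2 = (h11 p + h22 p) * h p)"
      using pos C2_jet_imp_C2_on[OF assms lnjet]
      unfolding log_harmonic_on_def harmonic_on_def by auto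
    with cmc show ?thesis
      by auto
  qed
  have "\<exists>h1 h2 h11 h12 h21 h22. C2_jet U h h1 h2 h11 h12 h21 h22"
    if C2: "C2_on U (graph_map h)"
  proof -
    obtain f1 f2 f11 f12 f21 f22 where "C2_jet U (graph_map h) f1 f2 f11 f12 f21 f22"
      using C2_on_imp_jet[OF assms C2] by metis
    moreover have "bounded_linear (\<lambda>u::real \<times> real \<times> real. snd (snd u))"
      by (intro bounded_linear_snd_comp bounded_linear_snd)
    ultimately show ?thesis
      using C2_jet_linear_image[of "\<lambda>u. snd (snd u)" U "graph_map h"]
      by (simp add: graph_map_def) blast
  qed
  then have jet: "\<exists>h1 h2 h11 h12 h21 h22. C2_jet U h h1 h2 h11 h12 h21 h22"
    if "spacelike_immersion B U (graph_map h)"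
    using that unfolding spacelike_immersion_def by blast
  show ?thesis (is "?L \<longleftrightarrow> ?R")
  proof
    assume L: ?L
    then have imm: "spacelike_immersion B U (graph_map h)" and pos: "\<forall>p\<in>U. 0 < h p"
      unfolding cmc_modular_surface_def log_harmonic_on_def by blast+
    obtain h1 h2 h11 h12 h21 h22 where j: "C2_jet U h h1 h2 h11 h12 h21 h22"
      using jet[OF imm] by blast
    with key[OF pos j] L imm pos show ?R
      unfolding cmc_modular_surface_def by blast
  next
    assume ?R
    with key show ?L
      unfolding cmc_modular_surface_def by blast
  qed
qed

section \<open>Rigidity of the Hessian\<close>

text \<open>The first two hypotheses say that \<open>(u, v)\<close> is an eigenvector of the symmetric matrix with rows
  \<open>(p, q)\<close> and \<open>(q, r)\<close> for the eigenvalue \<open>H\<close>. By the trace condition, subtracting \<open>H\<close> from the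
  diagonal leaves a symmetric traceless matrix. Such a matrix multiplies all lengths by
  \<open>sqrt ((p - H)\<^sup>2 + q\<^sup>2)\<close>; since it annihilates \<open>(u, v) \<noteq> 0\<close>, it is zero.\<close>

lemma symmetric_matrix_eq_scalar:
  fixes u v p q r H :: real
  assumes "p * u + q * v = H * u" "q * u + r * v = H * v" "p + r = 2 * H" "u\<^sup>2 + v\<^sup>2 \<noteq> 0"
  shows "p = H" "q = 0" "r = H"
proof -
  have r: "r = 2 * H - p" using assms(3) by simp
  have "((p - H)\<^sup>2 + q\<^sup>2) * (u\<^sup>2 + v\<^sup>2) = 0"
  proof -
    have 1: "(p - H) * u + q * v = 0" using assms(1) by (simp add: algebra_simps)
    have 2: "q * u - (p - H) * v = 0" using assms(2) unfolding r by (simp add: algebra_simps)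
    have "((p - H)\<^sup>2 + q\<^sup>2) * (u\<^sup>2 + v\<^sup>2) = ((p - H) * u + q * v)\<^sup>2 + (q * u - (p - H) * v)\<^sup>2"
      by (simp add: algebra_simps power2_eq_square)
    then show ?thesis by (simp only: 1 2) simp
  qed
  then have "(p - H)\<^sup>2 + q\<^sup>2 = 0" using assms(4) unfolding mult_eq_0_iff by blast
  then show "p = H" "q = 0" "r = H" using r by auto
qed

text \<open>Differentiating \<open>|\<nabla>h|\<^sup>2 = 2Hh\<close> shows that \<open>\<nabla>h\<close> is an eigenvector of the Hessian for the
  eigenvalue \<open>H\<close>. It is non-zero because \<open>h > 0\<close> and \<open>H \<noteq> 0\<close>.\<close>

lemma C2_jet_hessian_scalar:
  fixes h :: "real \<times> real \<Rightarrow> real"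
  assumes "open U" "H \<noteq> 0" and pos: "\<forall>p\<in>U. 0 < h p"
    and jet: "C2_jet U h h1 h2 h11 h12 h21 h22"
    and lap: "\<forall>p\<in>U. h11 p + h22 p = 2 * H"
    and grad: "\<forall>p\<in>U. (h1 p)\<^sup>2 + (h2 p)\<^sup>2 = 2 * H * h p"
    and "p \<in> U"
  shows "h11 p = H" "h12 p = 0" "h21 p = 0" "h22 p = H"
proof -
  have g: "has_gradient h (h1 p) (h2 p) p" "has_gradient h1 (h11 p) (h12 p) p"
    "has_gradient h2 (h21 p) (h22 p) p"
    using jet \<open>p \<in> U\<close> unfolding C2_jet_def by auto
  \<comment> \<open>The gradient of \<open>2Hh\<close>, computed from both sides of the second equation.\<close>
  have left: "has_gradient (\<lambda>q. 2 * H * h q) (2 * H * h1 p) (2 * H * h2 p) p"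
    using has_derivative_mult_right[OF g(1)[unfolded has_gradient_def], of "2 * H"]
    by (simp add: has_gradient_def distrib_left mult.left_commute)
  have lhs: "has_gradient (\<lambda>q. (h1 q)\<^sup>2 + (h2 q)\<^sup>2)
      (2 * (h11 p * h1 p + h21 p * h2 p)) (2 * (h12 p * h1 p + h22 p * h2 p)) p"
    using has_derivative_add[OF has_derivative_power[OF g(2)[unfolded has_gradient_def], of 2]
        has_derivative_power[OF g(3)[unfolded has_gradient_def], of 2]]
    by (simp add: has_gradient_def algebra_simps)
  have right: "has_gradient (\<lambda>q. 2 * H * h q)
      (2 * (h11 p * h1 p + h21 p * h2 p)) (2 * (h12 p * h1 p + h22 p * h2 p)) p"
    by (rule has_gradient_transform[OF lhs assms(1) \<open>p \<in> U\<close>]) (use grad in blast)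
  have "2 * H * h1 p = 2 * (h11 p * h1 p + h21 p * h2 p)"
    using partial_eq_gradient(1)[OF left] partial_eq_gradient(1)[OF right] by (rule trans[OF sym])
  moreover have "2 * H * h2 p = 2 * (h12 p * h1 p + h22 p * h2 p)"
    using partial_eq_gradient(2)[OF left] partial_eq_gradient(2)[OF right] by (rule trans[OF sym])
  moreover have mixed_eq: "h12 p = h21 p"
    by (rule C2_jet_symmetric[OF assms(1) jet \<open>p \<in> U\<close>])
  ultimately have "h11 p * h1 p + h12 p * h2 p = H * h1 p" "h12 p * h1 p + h22 p * h2 p = H * h2 p"
    by simp_all
  moreover have "h11 p + h22 p = 2 * H"
    using lap \<open>p \<in> U\<close> by blast
  moreover have "(h1 p)\<^sup>2 + (h2 p)\<^sup>2 \<noteq> 0"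
    using pos[rule_format, OF \<open>p \<in> U\<close>] \<open>H \<noteq> 0\<close>
    unfolding grad[rule_format, OF \<open>p \<in> U\<close>] by simp
  ultimately show "h11 p = H" "h12 p = 0" "h22 p = H"
    by (rule symmetric_matrix_eq_scalar)+
  with mixed_eq show "h21 p = 0"
    by simp
qed

text \<open>A constant Hessian makes the gradient affine on balls, with constants \<open>a, b\<close> that may change from
  ball to ball when \<open>U\<close> is disconnected. The gradient equation then gives \<open>h\<close> algebraically, and
  thereby the constant term \<open>(a\<^sup>2 + b\<^sup>2) / (2H)\<close>.\<close>

lemma locally_paraboloid_if_hessian_scalar:
  assumes "open U" "H \<noteq> 0"
    and jet: "C2_jet U h h1 h2 (\<lambda>_. H) (\<lambda>_. 0) (\<lambda>_. 0) (\<lambda>_. H)"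
    and grad: "\<forall>p\<in>U. (h1 p)\<^sup>2 + (h2 p)\<^sup>2 = 2 * H * h p"
  shows "locally_paraboloid U h H"
  unfolding locally_paraboloid_def
proof
  fix p assume "p \<in> U"
  then obtain r where r: "0 < r" "ball p r \<subseteq> U"
    using assms(1) open_contains_ball by blast
  have zero: "((\<lambda>q. h1 q - H * fst q) has_derivative (\<lambda>_. 0)) (at q within ball p r)"
    "((\<lambda>q. h2 q - H * snd q) has_derivative (\<lambda>_. 0)) (at q within ball p r)"
    if "q \<in> ball p r" for q
  proof -
    have "(h1 has_derivative (\<lambda>v. H * fst v)) (at q)" "(h2 has_derivative (\<lambda>v. H * snd v)) (at q)"
      using jet that r(2) unfolding C2_jet_def has_gradient_def by (auto simp: mult.commute)
    from has_derivative_diff[OF this(1) has_derivative_mult_right[OF has_derivative_fst[OF has_derivative_ident]], of H]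
      has_derivative_diff[OF this(2) has_derivative_mult_right[OF has_derivative_snd[OF has_derivative_ident]], of H]
    show "((\<lambda>q. h1 q - H * fst q) has_derivative (\<lambda>_. 0)) (at q within ball p r)"
      "((\<lambda>q. h2 q - H * snd q) has_derivative (\<lambda>_. 0)) (at q within ball p r)"
      by (simp_all add: has_derivative_at_withinI)
  qed
  obtain a where a: "\<forall>q\<in>ball p r. h1 q - H * fst q = a"
    using has_derivative_zero_constant[OF convex_ball zero(1)] by blast
  obtain b where b: "\<forall>q\<in>ball p r. h2 q - H * snd q = b"
    using has_derivative_zero_constant[OF convex_ball zero(2)] by blast
  have "h (x, y) = H/2 * (x\<^sup>2 + y\<^sup>2) + a * x + b * y + (a\<^sup>2 + b\<^sup>2) / (2 * H)"
    if "(x, y) \<in> ball p r" for x y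
  proof -
    have "h1 (x, y) = H * x + a" "h2 (x, y) = H * y + b"
      using a[rule_format, OF that] b[rule_format, OF that] by (simp_all add: algebra_simps)
    then have "2 * H * h (x, y) = (H * x + a)\<^sup>2 + (H * y + b)\<^sup>2"
      using grad r(2) that by (metis subsetD)
    then have "h (x, y) = ((H * x + a)\<^sup>2 + (H * y + b)\<^sup>2) / (2 * H)"
      using \<open>H \<noteq> 0\<close> by (simp add: field_simps)
    also have "\<dots> = H/2 * (x\<^sup>2 + y\<^sup>2) + a * x + b * y + (a\<^sup>2 + b\<^sup>2) / (2 * H)"
      using \<open>H \<noteq> 0\<close> by (simp add: field_simps power2_eq_square)
    finally show ?thesis .
  qed
  then show "\<exists>V a b. open V \<and> p \<in> V \<and> V \<subseteq> U \<and> (\<forall>x y. (x, y) \<in> V \<longrightarrow>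
      h (x, y) = H/2 * (x\<^sup>2 + y\<^sup>2) + a * x + b * y + (a\<^sup>2 + b\<^sup>2) / (2 * H))"
    using r by (intro exI[of _ "ball p r"] exI[of _ a] exI[of _ b]) auto
qed

text \<open>Different points may carry different \<open>a, b\<close>, so the global functions \<open>h1, h2\<close> are taken to be the
  partial derivatives of \<open>h\<close> and are computed in each neighbourhood separately. The gradient equation
  is the completion of squares \<open>2Hh = (Hx + a)\<^sup>2 + (Hy + b)\<^sup>2\<close>.\<close>

lemma hessian_scalar_if_locally_paraboloid:
  assumes "H \<noteq> 0" "locally_paraboloid U h H"
  obtains h1 h2 where "C2_jet U h h1 h2 (\<lambda>_. H) (\<lambda>_. 0) (\<lambda>_. 0) (\<lambda>_. H)"
    and "\<forall>p\<in>U. (h1 p)\<^sup>2 + (h2 p)\<^sup>2 = 2 * H * h p"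
proof -
  have main: "has_gradient h (partial (1,0) h p) (partial (0,1) h p) p \<and>
      has_gradient (partial (1,0) h) H 0 p \<and> has_gradient (partial (0,1) h) 0 H p \<and>
      (partial (1,0) h p)\<^sup>2 + (partial (0,1) h p)\<^sup>2 = 2 * H * h p" if p: "p \<in> U" for p
  proof -
    obtain V a b where V: "open V" "p \<in> V" and h: "\<forall>x y. (x, y) \<in> V \<longrightarrow>
        h (x, y) = H/2 * (x\<^sup>2 + y\<^sup>2) + a * x + b * y + (a\<^sup>2 + b\<^sup>2) / (2 * H)"
      using bspec[OF assms(2)[unfolded locally_paraboloid_def] p] by (elim exE conjE) (rule that)
    let ?k = "\<lambda>q. H/2 * ((fst q)\<^sup>2 + (snd q)\<^sup>2) + a * fst q + b * snd q + (a\<^sup>2 + b\<^sup>2) / (2 * H)"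
    have hk: "?k q = h q" if "q \<in> V" for q
      using h that by (cases q) auto
    have k: "has_gradient ?k (H * fst q + a) (H * snd q + b) q" for q
      unfolding has_gradient_def
      by (rule derivative_eq_intros refl)+ (simp add: fun_eq_iff algebra_simps)
    have grad: "has_gradient h (H * fst q + a) (H * snd q + b) q" if "q \<in> V" for q
      by (rule has_gradient_transform[OF k V(1) that hk])
    note partials = partial_eq_gradient[OF grad]
    have affine: "has_gradient (\<lambda>q. H * fst q + a) H 0 p" "has_gradient (\<lambda>q. H * snd q + b) 0 H p"
      unfolding has_gradient_def by (auto intro!: derivative_eq_intros simp: mult.commute)
    have "has_gradient (partial (1,0) h) H 0 p"
      by (rule has_gradient_transform[OF affine(1) V]) (simp add: partials)
    moreover have "has_gradient (partial (0,1) h) 0 H p"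
      by (rule has_gradient_transform[OF affine(2) V]) (simp add: partials)
    moreover have "(H * fst p + a)\<^sup>2 + (H * snd p + b)\<^sup>2 = 2 * H * h p"
      unfolding hk[OF V(2), symmetric] using assms(1) by (simp add: field_simps power2_eq_square)
    ultimately show ?thesis
      unfolding partials[OF V(2)] using grad[OF V(2)] by blast
  qed
  have "C2_jet U h (partial (1,0) h) (partial (0,1) h) (\<lambda>_. H) (\<lambda>_. 0) (\<lambda>_. 0) (\<lambda>_. H)"
    unfolding C2_jet_def using main by (intro conjI ballI continuous_on_const) blast+
  then show thesis
    by (rule that) (use main in blast)
qed

section \<open>The classification\<close>

text \<open>In Euclidean space a \<open>C\<^sup>2\<close> graph is always an immersion: the derivative sends \<open>v\<close> to a vector
  whose first two coordinates are those of \<open>v\<close>. This is why the immersion condition appears only in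
  the Minkowski half of the classification, where it restricts the slope of \<open>h\<close>.\<close>

lemma spacelike_immersion_inner_graph_map:
  assumes "open U" and jet: "C2_jet U h h1 h2 h11 h12 h21 h22"
  shows "spacelike_immersion inner U (graph_map h)"
proof -
  note gjet = C2_jet_graph_map[OF jet]
  have "0 < pullback_metric inner (graph_map h) p v v" if "p \<in> U" "v \<noteq> 0" for p v
  proof -
    have "(graph_map h has_derivative (\<lambda>v. fst v *\<^sub>R (1, 0, h1 p) + snd v *\<^sub>R (0, 1, h2 p))) (at p)"
      using gjet that(1) unfolding C2_jet_def has_gradient_def by auto
    from frechet_derivative_at[OF this, symmetric]
    have "frechet_derivative (graph_map h) (at p) v \<noteq> 0"
      using that(2) by (auto simp: prod_eq_iff)
    then show ?thesis
      by (simp add: pullback_metric_def)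
  qed
  then show ?thesis
    using C2_jet_imp_C2_on[OF assms(1) gjet] by (simp add: spacelike_immersion_def)
qed

lemma cmc_modular_surface_iff_locally_paraboloid:
  assumes "open U" "H \<noteq> 0"
  shows "cmc_modular_surface B U h H \<longleftrightarrow>
    (\<forall>p\<in>U. 0 < h p) \<and> spacelike_immersion B U (graph_map h) \<and> locally_paraboloid U h H"
proof
  assume "cmc_modular_surface B U h H"
  then obtain h1 h2 h11 h12 h21 h22 where pos: "\<forall>p\<in>U. 0 < h p"
    and imm: "spacelike_immersion B U (graph_map h)"
    and jet: "C2_jet U h h1 h2 h11 h12 h21 h22"
    and eqs: "\<forall>p\<in>U. h11 p + h22 p = 2 * H" "\<forall>p\<in>U. (h1 p)\<^sup>2 + (h2 p)\<^sup>2 = 2 * H * h p"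
    unfolding cmc_modular_surface_iff[OF assms(1)] by blast
  have "C2_jet U h h1 h2 (\<lambda>_. H) (\<lambda>_. 0) (\<lambda>_. 0) (\<lambda>_. H)"
    using jet C2_jet_hessian_scalar[OF assms pos jet eqs] unfolding C2_jet_def by simp
  from locally_paraboloid_if_hessian_scalar[OF assms this eqs(2)] pos imm
  show "(\<forall>p\<in>U. 0 < h p) \<and> spacelike_immersion B U (graph_map h) \<and> locally_paraboloid U h H"
    by blast
next
  assume R: "(\<forall>p\<in>U. 0 < h p) \<and> spacelike_immersion B U (graph_map h) \<and> locally_paraboloid U h H"
  then obtain h1 h2 where "C2_jet U h h1 h2 (\<lambda>_. H) (\<lambda>_. 0) (\<lambda>_. 0) (\<lambda>_. H)"
    and "\<forall>p\<in>U. (h1 p)\<^sup>2 + (h2 p)\<^sup>2 = 2 * H * h p"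
    using hessian_scalar_if_locally_paraboloid[OF assms(2)] by metis
  then have "\<exists>h1 h2 h11 h12 h21 h22. C2_jet U h h1 h2 h11 h12 h21 h22 \<and>
      (\<forall>p\<in>U. h11 p + h22 p = 2 * H \<and> (h1 p)\<^sup>2 + (h2 p)\<^sup>2 = 2 * H * h p)"
    by (intro exI conjI) auto
  with R show "cmc_modular_surface B U h H"
    unfolding cmc_modular_surface_iff[OF assms(1)] by blast
qed

theorem theorem5p1:
  fixes U :: "(real \<times> real) set" and h :: "real \<times> real \<Rightarrow> real" and H :: real
  assumes "open U" and "H \<noteq> 0"
  shows "(cmc_modular_surface inner U h H \<longleftrightarrow>
            (\<forall>p\<in>U. 0 < h p) \<and> locally_paraboloid U h H) \<and>
         (cmc_modular_surface minkowski U h H \<longleftrightarrow>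
            (\<forall>p\<in>U. 0 < h p) \<and> spacelike_immersion minkowski U (graph_map h) \<and>
            locally_paraboloid U h H)"
proof -
  have "spacelike_immersion inner U (graph_map h)" if "locally_paraboloid U h H"
    using hessian_scalar_if_locally_paraboloid[OF assms(2) that]
      spacelike_immersion_inner_graph_map[OF assms(1)] by metis
  then show ?thesis
    using cmc_modular_surface_iff_locally_paraboloid[OF assms] by blast
qed

end
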